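(* Let $\delta\in(0,1)$ and let $\alpha\in(0,1)$ be irrational of Diophantine class $\nu\in[1,+\infty]$. Let $f\colon S^1\to S^1$ be a Denjoy map that is semi-conjugate to the rotation $R_\alpha$, with gaps $J_n$, $n\in\mathbb{Z}$, whose lengths $|J_n|=\ell_n$ form a Denjoy sequence of class $\delta$, and let $\Omega_f=S^1\setminus\bigcup_{n\in\mathbb{Z}}J_n$ be its minimal set. Then $$\dim_H(\Omega_f)\geq\frac{\delta}{\nu}.$$
   Context: $S^1$ is the circle of total length $1$ with the arc-length metric, and $R_\alpha(t)=t+\alpha \pmod 1$. $\|x\|$ is the distance from $x$ to the nearest integer. If $\nu=+\infty$, $\delta/\nu$ is read as $0$. Denjoy sequence of class $\delta\in(0,1)$: a sequence $(\ell_n)_{n\in\mathbb{Z}}$ of non-negative numbers (such that the logarithms below make sense) with $$\sum_{n\in\mathbb{Z}}\ell_n=1\qquad\text{and}\qquad \liminf_{n\to\pm\infty}\frac{\ln|\ell_n-\ell_{n+1}|}{\ln \ell_n}=1+\delta .$$ Denjoy map: given an irrational $\alpha\in(0,1)$ and a Denjoy sequence $(\ell_n)_{n\in\mathbb{Z}}$ of class $\delta$, start with the circle of length $1$ and the rotation $R_\alpha$, and blow up every point $n\alpha$ ($n\in\mathbb{Z}$) of the orbit of $0$ to an open arc $J_n$ of length $|J_n|=\ell_n$, rescaling the rest so that the total length remains $1$. Thus the arcs $J_n$ are pairwise disjoint and are placed on $S^1$ in the same cyclic order as the points $n\alpha$. The Denjoy map $f\colon S^1\to S^1$ is an orientation preserving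 diffeomorphism, of class $C^{1+\delta}$, mapping each $J_n$ diffeomorphically onto $J_{n+1}$ with derivative $1$ at the endpoints. It is semi-conjugate to $R_\alpha$, i.e. $h\circ f=R_\alpha\circ h$, by the continuous monotone surjection $h\colon S^1\to S^1$ that collapses the closure of each $J_n$ to the point $n\alpha$ and is injective elsewhere. The set $\Omega_f=S^1\setminus\bigcup_{n\in\mathbb{Z}}J_n$ is the unique minimal set of $f$. Diophantine class: an irrational $\alpha\in(0,1)$ is of Diophantine class $\nu\in[1,+\infty]$ if the inequality $\|q\alpha\|<q^{-\mu}$ has infinitely many positive integer solutions $q$ for every $\mu<\nu$ and only finitely many for every $\mu>\nu$. Hausdorff measure and dimension: $H_\beta(Y)=\lim_{r\to0}\inf\{\sum_{k=1}^\infty(\operatorname{diam}U_k)^\beta : \operatorname{diam}U_k<r \text{ for all } k,\ Y\subset\bigcup_{k=1}^\infty U_k\}$ and $\dim_H(Y)=\inf\{\beta\ge0 : H_\beta(Y)=0\}$. *)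

theory Defs
  imports "HOL-Analysis.Analysis"
begin

definition dist_int :: "real \<Rightarrow> real" where
  "dist_int x = \<bar>x - of_int (round x)\<bar>"

lemma dist_int_le: "dist_int x \<le> \<bar>x - of_int k\<bar>"
  unfolding dist_int_def using round_diff_minimal[of x k] by (simp add: abs_minus_commute)

lemma dist_int_add_of_int: "dist_int (x + of_int k) = dist_int x"
proof (rule antisym)
  show "dist_int (x + of_int k) \<le> dist_int x"
    using dist_int_le[of "x + of_int k" "round x + k"] by (simp add: dist_int_def)
  show "dist_int x \<le> dist_int (x + of_int k)"
    using dist_int_le[of x "round (x + of_int k) - k"]
    unfolding dist_int_def[of "x + of_int k"] by (simp add: algebra_simps)
qed

lemma dist_int_minus: "dist_int (- x) = dist_int x"
proof -
  have "dist_int (- y) \<le> dist_int y" for y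
    using dist_int_le[of "- y" "- round y"] by (simp add: dist_int_def)
  from this[of x] this[of "- x"] show ?thesis by simp
qed

lemma dist_int_triangle: "dist_int (x + y) \<le> dist_int x + dist_int y"
  using dist_int_le[of "x + y" "round x + round y"] by (simp add: dist_int_def)

lemma dist_int_eq_0_iff: "dist_int x = 0 \<longleftrightarrow> x \<in> \<int>"
proof
  show "x \<in> \<int>" if "dist_int x = 0"
    using that Ints_of_int[of "round x", where 'a = real]
    unfolding dist_int_def by (metis abs_eq_0 eq_iff_diff_eq_0)
  show "dist_int x = 0" if "x \<in> \<int>"
    using that by (auto simp: dist_int_def elim!: Ints_cases)
qed

definition diophantine_class :: "real \<Rightarrow> ereal \<Rightarrow> bool" where
  "diophantine_class \<alpha> \<nu> \<longleftrightarrow>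
     (\<forall>\<mu>::real. ereal \<mu> < \<nu> \<longrightarrow>
        infinite {q::nat. q > 0 \<and> dist_int (real q * \<alpha>) < real q powr (- \<mu>)}) \<and>
     (\<forall>\<mu>::real. ereal \<mu> > \<nu> \<longrightarrow>
        finite {q::nat. q > 0 \<and> dist_int (real q * \<alpha>) < real q powr (- \<mu>)})"

quotient_type circle = real / "\<lambda>x y::real. x - y \<in> \<int>"
proof (rule equivpI)
  show "reflp (\<lambda>x y::real. x - y \<in> \<int>)" by (simp add: reflp_def)
  show "symp (\<lambda>x y::real. x - y \<in> \<int>)"
    by (metis (no_types, lifting) Ints_minus minus_diff_eq sympI)
  show "transp (\<lambda>x y::real. x - y \<in> \<int>)"
  proof (rule transpI)
    fix x y z :: real
    assume "x - y \<in> \<int>" "y - z \<in> \<int>"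
    from Ints_add[OF this] show "x - z \<in> \<int>" by simp
  qed
qed

lift_definition circ :: "real \<Rightarrow> circle" is "\<lambda>x. x" .

lift_definition rotation :: "real \<Rightarrow> circle \<Rightarrow> circle" is "\<lambda>\<alpha> t. t + \<alpha>" by simp

lift_definition circle_dist :: "circle \<Rightarrow> circle \<Rightarrow> real" is "\<lambda>x y. dist_int (x - y)"
proof -
  fix x x' y y' :: real
  assume "x - x' \<in> \<int>" "y - y' \<in> \<int>"
  then obtain k where "(x - x') - (y - y') = of_int k"
    by (metis Ints_cases Ints_diff)
  then have "x - y = (x' - y') + of_int k" by simp
  then show "dist_int (x - y) = dist_int (x' - y')"
    by (simp only: dist_int_add_of_int)
qed

instantiation circle :: metric_space
begin

definition dist_circle :: "circle \<Rightarrow> circle \<Rightarrow> real" where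
  "dist_circle = circle_dist"

definition uniformity_circle :: "(circle \<times> circle) filter" where
  "uniformity_circle = (INF e\<in>{0<..}. principal {(x, y). dist x y < e})"

definition open_circle :: "circle set \<Rightarrow> bool" where
  "open_circle U \<longleftrightarrow> (\<forall>x\<in>U. eventually (\<lambda>(x', y). x' = x \<longrightarrow> y \<in> U) uniformity)"

instance
proof
  fix x y z :: circle
  show "dist x y = 0 \<longleftrightarrow> x = y"
    unfolding dist_circle_def by transfer (simp add: dist_int_eq_0_iff)
  show "dist x y \<le> dist x z + dist y z"
    unfolding dist_circle_def
  proof transfer
    fix x y z :: real
    show "dist_int (x - y) \<le> dist_int (x - z) + dist_int (y - z)"
      using dist_int_triangle[of "x - z" "z - y"] dist_int_minus[of "y - z"] by simp
  qed
qed (simp_all add: uniformity_circle_def open_circle_def)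

end

lemma dist_circ: "dist (circ x) (circ y) = dist_int (x - y)"
  unfolding dist_circle_def by transfer simp

lemma circ_eq_iff: "circ x = circ y \<longleftrightarrow> x - y \<in> \<int>"
  by transfer simp

lemma rotation_circ: "rotation \<alpha> (circ t) = circ (t + \<alpha>)"
  by transfer simp

definition open_arc :: "real \<Rightarrow> real \<Rightarrow> circle set" where
  "open_arc a l = circ ` {a<..<a + l}"

text \<open>The points are pairwise distinct and are met in this order when the circle is
  traversed once in the positive direction.\<close>

definition cyclically_ordered :: "circle \<Rightarrow> circle \<Rightarrow> circle \<Rightarrow> bool" where
  "cyclically_ordered x y z \<longleftrightarrow>
     (\<exists>a b c. a < b \<and> b < c \<and> c < a + 1 \<and> x = circ a \<and> y = circ b \<and> z = circ c)"

text \<open>Lifts of continuous circle maps of degree 1.\<close>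

definition circle_lift :: "(real \<Rightarrow> real) \<Rightarrow> (circle \<Rightarrow> circle) \<Rightarrow> bool" where
  "circle_lift F f \<longleftrightarrow>
     continuous_on UNIV F \<and> (\<forall>x. F (x + 1) = F x + 1) \<and> (\<forall>x. f (circ x) = circ (F x))"

definition has_circle_derivative :: "(circle \<Rightarrow> circle) \<Rightarrow> real \<Rightarrow> circle \<Rightarrow> bool" where
  "has_circle_derivative f D p \<longleftrightarrow>
     (\<exists>F x. circle_lift F f \<and> circ x = p \<and> (F has_real_derivative D) (at x))"

definition circle_C1_holder :: "real \<Rightarrow> (circle \<Rightarrow> circle) \<Rightarrow> bool" where
  "circle_C1_holder \<delta> f \<longleftrightarrow>
     (\<exists>F F'. circle_lift F f \<and> (\<forall>x. (F has_real_derivative F' x) (at x)) \<and>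
        (\<exists>C. \<forall>x y. \<bar>F' x - F' y\<bar> \<le> C * \<bar>x - y\<bar> powr \<delta>))"

text \<open>A circle homeomorphism preserves orientation iff it has degree 1, which is
  built into \<^const>\<open>circle_lift\<close>.\<close>

definition circle_diffeo :: "real \<Rightarrow> (circle \<Rightarrow> circle) \<Rightarrow> bool" where
  "circle_diffeo \<delta> f \<longleftrightarrow> bij f \<and> circle_C1_holder \<delta> f \<and> circle_C1_holder \<delta> (inv f)"

definition circle_monotone :: "(circle \<Rightarrow> circle) \<Rightarrow> bool" where
  "circle_monotone h \<longleftrightarrow> (\<exists>H. circle_lift H h \<and> mono H)"

definition ext_ln :: "real \<Rightarrow> ereal" where
  "ext_ln x = (if x = 0 then - \<infinity> else ereal (ln x))"

text \<open>The lengths are positive, and less than 1 because of the sum, so that the denominator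
  below is a negative real number. If two consecutive lengths coincide, the quotient
  is \<open>\<infinity>\<close>.\<close>

definition denjoy_sequence :: "real \<Rightarrow> (int \<Rightarrow> real) \<Rightarrow> bool" where
  "denjoy_sequence \<delta> \<l> \<longleftrightarrow>
     (\<forall>n. \<l> n > 0) \<and> (\<l> has_sum 1) UNIV \<and>
     Liminf (sup at_top at_bot) (\<lambda>n. ext_ln \<bar>\<l> n - \<l> (n + 1)\<bar> / ext_ln (\<l> n)) = ereal (1 + \<delta>)"

definition denjoy_semiconjugacy ::
  "real \<Rightarrow> (int \<Rightarrow> circle set) \<Rightarrow> (circle \<Rightarrow> circle) \<Rightarrow> (circle \<Rightarrow> circle) \<Rightarrow> bool" where
  "denjoy_semiconjugacy \<alpha> J f h \<longleftrightarrow>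
     continuous_on UNIV h \<and> circle_monotone h \<and> surj h \<and>
     h \<circ> f = rotation \<alpha> \<circ> h \<and>
     (\<forall>n. h ` closure (J n) = {circ (of_int n * \<alpha>)}) \<and>
     inj_on h (- (\<Union>n. closure (J n)))"

definition denjoy_map ::
  "real \<Rightarrow> real \<Rightarrow> (int \<Rightarrow> real) \<Rightarrow> (int \<Rightarrow> circle set) \<Rightarrow> (circle \<Rightarrow> circle) \<Rightarrow> bool" where
  "denjoy_map \<delta> \<alpha> \<l> J f \<longleftrightarrow>
     denjoy_sequence \<delta> \<l> \<and>
     disjoint_family J \<and>
     (\<forall>i j k. cyclically_ordered (circ (of_int i * \<alpha>)) (circ (of_int j * \<alpha>)) (circ (of_int k * \<alpha>)) \<longrightarrow>
        (\<forall>x\<in>J i. \<forall>y\<in>J j. \<forall>z\<in>J k. cyclically_ordered x y z)) \<and>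
     circle_diffeo \<delta> f \<and>
     (\<forall>n. f ` J n = J (n + 1)) \<and>
     (\<forall>n. \<exists>a. J n = open_arc a (\<l> n) \<and>
        has_circle_derivative f 1 (circ a) \<and> has_circle_derivative f 1 (circ (a + \<l> n))) \<and>
     (\<exists>h. denjoy_semiconjugacy \<alpha> J f h)"

text \<open>The \<open>\<beta>\<close>-th power of the diameter, with \<open>0\<^sup>0 = 1\<close> for nonempty sets and with the
  empty set contributing 0, so that finite covers are admitted for \<open>\<beta> = 0\<close> as well.\<close>

definition diam_pow :: "real \<Rightarrow> 'a::metric_space set \<Rightarrow> ennreal" where
  "diam_pow \<beta> U =
     (if U = {} then 0 else if \<beta> = 0 then 1 else ennreal (diameter U powr \<beta>))"

text \<open>Boundedness is required because \<^const>\<open>diameter\<close> is only meaningful for bounded sets.\<close>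

definition hausdorff_premeasure :: "real \<Rightarrow> real \<Rightarrow> 'a::metric_space set \<Rightarrow> ennreal" where
  "hausdorff_premeasure \<beta> r Y =
     (INF U\<in>{U :: nat \<Rightarrow> 'a set. (\<forall>k. bounded (U k) \<and> diameter (U k) < r) \<and> Y \<subseteq> (\<Union>k. U k)}.
        \<Sum>k. diam_pow \<beta> (U k))"

definition hausdorff_measure :: "real \<Rightarrow> 'a::metric_space set \<Rightarrow> ennreal" where
  "hausdorff_measure \<beta> Y = Lim (at_right 0) (\<lambda>r. hausdorff_premeasure \<beta> r Y)"

lemma hausdorff_premeasure_antimono:
  "r \<le> s \<Longrightarrow> hausdorff_premeasure \<beta> s Y \<le> hausdorff_premeasure \<beta> r Y"
  unfolding hausdorff_premeasure_def
  by (rule INF_superset_mono) (auto intro: less_le_trans)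

lemma hausdorff_premeasure_tendsto:
  "((\<lambda>r. hausdorff_premeasure \<beta> r Y) \<longlongrightarrow> (SUP r\<in>{0<..}. hausdorff_premeasure \<beta> r Y)) (at_right 0)"
proof (rule order_tendstoI)
  fix a assume "a < (SUP r\<in>{0<..}. hausdorff_premeasure \<beta> r Y)"
  then obtain s where s: "s > 0" "a < hausdorff_premeasure \<beta> s Y"
    by (auto simp: less_SUP_iff)
  have "\<forall>\<^sub>F r in at_right 0. r \<in> {0<..<s}"
    using s by (intro eventually_at_right_real)
  then show "\<forall>\<^sub>F r in at_right 0. a < hausdorff_premeasure \<beta> r Y"
    by eventually_elim
       (auto intro!: less_le_trans[OF s(2)] hausdorff_premeasure_antimono)
next
  fix a assume a: "(SUP r\<in>{0<..}. hausdorff_premeasure \<beta> r Y) < a"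
  have "hausdorff_premeasure \<beta> r Y < a" if "r > 0" for r
    using that by (intro le_less_trans[OF _ a] SUP_upper) auto
  then show "\<forall>\<^sub>F r in at_right 0. hausdorff_premeasure \<beta> r Y < a"
    using eventually_at_right_less[of "0::real"] by (rule eventually_mono[rotated])
qed

lemma hausdorff_measure_eq_SUP:
  "hausdorff_measure \<beta> Y = (SUP r\<in>{0<..}. hausdorff_premeasure \<beta> r Y)"
  unfolding hausdorff_measure_def
  by (rule tendsto_Lim[OF _ hausdorff_premeasure_tendsto]) simp

definition hausdorff_dim :: "'a::metric_space set \<Rightarrow> ereal" where
  "hausdorff_dim Y = Inf (ereal ` {\<beta>. \<beta> \<ge> 0 \<and> hausdorff_measure \<beta> Y = 0})"

end

theory Submission
  imports Defs
begin

text \<open>Push Lebesgue measure of the rotation back to the minimal set \<open>\<Omega>\<close>: if \<open>H\<close> is a monotone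
  lift of the semi-conjugacy, the mass of an arc \<open>[x, y]\<close> is \<open>H y - H x\<close>. By the mass
  distribution principle (\<open>hausdorff_dim_ge_of_holder_lift\<close>) the dimension of \<open>\<Omega>\<close> is at
  least \<open>s\<close> as soon as \<open>H\<close> is Hoelder continuous with exponent \<open>s\<close>, because the gaps only
  carry the countable set of values \<open>n \<alpha> + k\<close> and hence no mass.

  The Hoelder exponent results from two rates. First, if \<open>m\<close> is the mass of an arc and
  \<open>\<mu> > \<nu>\<close>, then some orbit point \<open>j \<alpha>\<close> with \<open>0 \<le> j < C m\<^sup>-\<^sup>\<mu>\<close> lies in the image of the
  arc (\<open>diophantine_return_time\<close>); the arc then contains the whole gap \<open>J\<^sub>j\<close>, so its length is at
  least \<open>\<l>\<^sub>j\<close>. Secondly, for \<open>\<sigma> < \<delta>\<close> the condition on the sequence says that \<open>\<l>\<^sub>n\<close> and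
  \<open>\<l>\<^sub>n\<^sub>+\<^sub>1\<close> eventually differ by at most \<open>\<l>\<^sub>n\<close> to the power \<open>1 + \<sigma>\<close>. This is a discrete version of
  the differential inequality \<open>\<bar>x'\<bar> \<le> x\<close> to the power \<open>1 + \<sigma>\<close>, for whose solutions the
  power \<open>- \<sigma>\<close> of \<open>x\<close> grows at most linearly
  (\<open>denjoy_sequence_forward_lower_bound\<close>). Together they bound \<open>m\<close> by a constant times the
  length to the power \<open>\<sigma> / \<mu>\<close>, and \<open>\<sigma> / \<mu>\<close> can be chosen as close to \<open>\<delta> / \<nu>\<close> as desired
  (\<open>denjoy_dim_ge\<close>). For \<open>\<nu> = \<infinity>\<close> the claim is only that the dimension is nonnegative.\<close>

section \<open>Polynomial lower bound for the lengths of the gaps\<close>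

text \<open>One step of the discrete differential inequality: passing from \<open>x\<close> to \<open>y\<close> loses at most the
  relative amount \<open>t = x powr s\<close>, which the power \<open>- s\<close> turns into the factor
  \<open>1 + O(t)\<close>, and \<open>t\<close> cancels against \<open>x powr (- s)\<close>.\<close>

lemma powr_neg_increment_le:
  fixes x y s :: real
  assumes s: "0 < s" "s < 1" and pos: "0 < x" "0 < y"
    and small: "x powr s \<le> 1 / 2" and close: "\<bar>x - y\<bar> \<le> x powr (1 + s)"
  shows "y powr (- s) \<le> x powr (- s) + 2"
proof -
  define t where "t = x powr s"
  have t: "0 < t" "t \<le> 1 / 2" using pos small by (auto simp: t_def)
  have "x powr (1 + s) = x * t" using pos by (simp add: t_def powr_add)
  with close have y: "x * (1 - t) \<le> y" by (simp add: algebra_simps)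
  have "y powr (- s) \<le> (x * (1 - t)) powr (- s)"
    using y s pos t by (intro powr_mono2') auto
  also have "\<dots> = x powr (- s) * (1 - t) powr (- s)"
    using pos t by (simp add: powr_mult)
  also have "\<dots> \<le> x powr (- s) * (1 - t) powr (- 1)"
    using s t by (intro mult_left_mono powr_mono') auto
  also have "(1 - t) powr (- 1) = 1 / (1 - t)"
    using t by (simp add: powr_minus_divide)
  also have "1 / (1 - t) \<le> 1 + 2 * t"
  proof -
    have "1 \<le> (1 + 2 * t) * (1 - t)"
      using mult_nonneg_nonneg[of t "1 - 2 * t"] t by (simp add: algebra_simps)
    then show ?thesis using t by (simp add: divide_le_eq)
  qed
  finally have "y powr (- s) \<le> x powr (- s) * (1 + 2 * t)"
    using pos by (simp add: mult_left_mono)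
  also have "x powr (- s) * t = 1"
    using pos by (simp add: t_def flip: powr_add)
  then have "x powr (- s) * (1 + 2 * t) = x powr (- s) + 2"
    by (simp add: algebra_simps)
  finally show ?thesis .
qed

text \<open>The constant absorbs the finitely many terms before the increments become controlled.\<close>

lemma linear_bound_of_increments:
  fixes u :: "nat \<Rightarrow> real"
  assumes inc: "\<And>n. n \<ge> N \<Longrightarrow> u (Suc n) \<le> u n + K" and K: "0 < K"
  obtains A where "A > 0" "\<And>n. u n \<le> A * (real n + 1)"
proof
  define A where "A = K + (\<Sum>i\<le>N. \<bar>u i\<bar>)"
  show A: "A > 0" using K by (simp add: A_def add_pos_nonneg sum_nonneg)
  show "u n \<le> A * (real n + 1)" for n
  proof (induction n)
    case 0
    have "\<bar>u 0\<bar> \<le> (\<Sum>i\<le>N. \<bar>u i\<bar>)" by (rule member_le_sum) auto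
    then show ?case using K by (simp add: A_def)
  next
    case (Suc n)
    show ?case
    proof (cases "n \<ge> N")
      case True
      have "K \<le> A" by (simp add: A_def sum_nonneg)
      then show ?thesis using inc[OF True] Suc.IH by (simp add: algebra_simps)
    next
      case False
      then have "\<bar>u (Suc n)\<bar> \<le> (\<Sum>i\<le>N. \<bar>u i\<bar>)" by (intro member_le_sum) auto
      then have "u (Suc n) \<le> A * 1" using K by (simp add: A_def)
      also have "\<dots> \<le> A * (real (Suc n) + 1)" using A by (intro mult_left_mono) auto
      finally show ?thesis .
    qed
  qed
qed

lemma denjoy_sequence_less_1:
  assumes "denjoy_sequence \<delta> \<l>"
  shows "\<l> n < 1"
proof -
  have pos: "\<And>k. \<l> k > 0" and sum: "(\<l> has_sum 1) UNIV"
    using assms by (auto simp: denjoy_sequence_def)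
  have "sum \<l> {n, n + 1} \<le> 1"
    by (rule finite_sum_le_has_sum[OF sum]) (use pos less_imp_le in auto)
  then show ?thesis using pos[of "n + 1"] by simp
qed

lemma denjoy_sequence_forward_tendsto_0:
  assumes "denjoy_sequence \<delta> \<l>"
  shows "(\<lambda>n::nat. \<l> (int n)) \<longlonglongrightarrow> 0"
proof -
  have "\<l> summable_on UNIV"
    using assms by (auto simp: denjoy_sequence_def summable_on_def)
  then have "\<l> summable_on range int" by (rule summable_on_subset_banach) simp
  then have "(\<l> \<circ> int) summable_on UNIV"
    by (subst (asm) summable_on_reindex) (auto simp: inj_on_def)
  then have "summable (\<l> \<circ> int)" by (rule summable_on_imp_summable)
  from summable_LIMSEQ_zero[OF this] show ?thesis by (simp add: o_def)
qed

text \<open>Both logarithms are negative, so a lower bound for their quotient is an upper bound for the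
  difference of the lengths. Equal consecutive lengths, where the quotient is infinite, are
  harmless.\<close>

lemma denjoy_sequence_eventually_close:
  assumes seq: "denjoy_sequence \<delta> \<l>" and s: "s < \<delta>"
  shows "\<forall>\<^sub>F n in at_top. \<bar>\<l> n - \<l> (n + 1)\<bar> \<le> \<l> n powr (1 + s)"
proof -
  have pos: "\<l> n > 0" for n using seq by (auto simp: denjoy_sequence_def)
  have "ereal (1 + s) < Liminf (sup at_top at_bot)
      (\<lambda>n. ext_ln \<bar>\<l> n - \<l> (n + 1)\<bar> / ext_ln (\<l> n))"
    using seq s by (simp add: denjoy_sequence_def)
  from less_LiminfD[OF this]
  have "\<forall>\<^sub>F n in at_top. ereal (1 + s) < ext_ln \<bar>\<l> n - \<l> (n + 1)\<bar> / ext_ln (\<l> n)"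
    by (simp add: eventually_sup)
  then show ?thesis
  proof eventually_elim
    case (elim n)
    show ?case
    proof (cases "\<l> n = \<l> (n + 1)")
      case True
      then show ?thesis by simp
    next
      case False
      define d where "d = \<bar>\<l> n - \<l> (n + 1)\<bar>"
      have d: "d > 0" using False by (simp add: d_def)
      have neg: "ln (\<l> n) < 0"
        using pos[of n] denjoy_sequence_less_1[OF seq, of n] by simp
      have "1 + s < ln d / ln (\<l> n)"
        using elim d pos[of n] neg unfolding d_def[symmetric] by (simp add: ext_ln_def)
      then have "ln d < (1 + s) * ln (\<l> n)"
        using neg by (simp add: neg_less_divide_eq)
      then have "ln d < ln (\<l> n powr (1 + s))" using pos[of n] by (simp add: ln_powr)
      then have "d < \<l> n powr (1 + s)" using d pos[of n] by (subst (asm) ln_less_cancel_iff) auto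
      then show ?thesis by (simp add: d_def)
    qed
  qed
qed

lemma denjoy_sequence_forward_lower_bound:
  assumes seq: "denjoy_sequence \<delta> \<l>" and s: "0 < s" "s < \<delta>" "\<delta> < 1"
  obtains A where "A > 0" "\<And>n::nat. \<l> (int n) powr (- s) \<le> A * (real n + 1)"
proof -
  have pos: "\<l> n > 0" for n using seq by (auto simp: denjoy_sequence_def)
  have "(\<lambda>n. \<l> (int n) powr s) \<longlonglongrightarrow> 0"
  proof -
    have "\<forall>\<^sub>F n in sequentially. 0 \<le> \<l> (int n)"
      by (intro always_eventually allI less_imp_le pos)
    then show ?thesis
      using tendsto_powr'[OF denjoy_sequence_forward_tendsto_0[OF seq] tendsto_const, of s] s by simp
  qed
  then have small: "\<forall>\<^sub>F n in sequentially. \<l> (int n) powr s < 1 / 2"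
    by (rule order_tendstoD) simp
  have close: "\<forall>\<^sub>F n in sequentially. \<bar>\<l> (int n) - \<l> (int n + 1)\<bar> \<le> \<l> (int n) powr (1 + s)"
    using denjoy_sequence_eventually_close[OF seq s(2)] filterlim_int_sequentially
    by (rule eventually_compose_filterlim)
  obtain N where N: "\<And>n. n \<ge> N \<Longrightarrow> \<l> (int n) powr s < 1 / 2"
    "\<And>n. n \<ge> N \<Longrightarrow> \<bar>\<l> (int n) - \<l> (int n + 1)\<bar> \<le> \<l> (int n) powr (1 + s)"
    using eventually_conj[OF small close] by (auto simp: eventually_sequentially)
  have "\<l> (int (Suc n)) powr (- s) \<le> \<l> (int n) powr (- s) + 2" if "n \<ge> N" for n
    using powr_neg_increment_le[of s "\<l> (int n)" "\<l> (int n + 1)"] N[OF that] s pos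
    by (simp add: add.commute)
  then show ?thesis
    by (rule linear_bound_of_increments[of N]) (use that in auto)
qed

section \<open>Return times of a Diophantine rotation\<close>

text \<open>The inequality with constant 1 has finitely many exceptions; none of them has value 0 because
  \<open>\<alpha>\<close> is irrational, so a smaller constant accommodates them all.\<close>

lemma diophantine_class_lower_bound:
  assumes irr: "\<alpha> \<notin> \<rat>" and dio: "diophantine_class \<alpha> \<nu>" and mu: "\<nu> < ereal \<mu>"
  obtains c where "c > 0" "\<And>q::nat. q > 0 \<Longrightarrow> c * real q powr (- \<mu>) \<le> dist_int (real q * \<alpha>)"
proof -
  define B where "B = {q::nat. q > 0 \<and> dist_int (real q * \<alpha>) < real q powr (- \<mu>)}"
  define X where "X = insert 1 ((\<lambda>q. dist_int (real q * \<alpha>) / real q powr (- \<mu>)) ` B)"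
  have fin: "finite X" using dio mu by (auto simp: X_def B_def diophantine_class_def)
  have pos: "dist_int (real q * \<alpha>) > 0" if "q > 0" for q :: nat
  proof -
    have "real q * \<alpha> \<notin> \<int>"
    proof
      assume "real q * \<alpha> \<in> \<int>"
      then have "real q * \<alpha> / real q \<in> \<rat>" using Ints_subset_Rats by (intro Rats_divide) auto
      with that irr show False by simp
    qed
    then have "dist_int (real q * \<alpha>) \<noteq> 0" by (simp add: dist_int_eq_0_iff)
    then show ?thesis by (simp add: dist_int_def)
  qed
  show ?thesis
  proof
    show "Min X > 0" using fin pos by (auto simp: X_def B_def)
    show "Min X * real q powr (- \<mu>) \<le> dist_int (real q * \<alpha>)" if "q > 0" for q
    proof (cases "q \<in> B")
      case True
      then have "Min X \<le> dist_int (real q * \<alpha>) / real q powr (- \<mu>)"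
        by (intro Min_le fin) (auto simp: X_def)
      then show ?thesis using that by (simp add: le_divide_eq)
    next
      case False
      have "Min X \<le> 1" by (intro Min_le fin) (auto simp: X_def)
      then have "Min X * real q powr (- \<mu>) \<le> 1 * real q powr (- \<mu>)"
        by (intro mult_right_mono) auto
      moreover have "real q powr (- \<mu>) \<le> dist_int (real q * \<alpha>)"
        using False that by (simp add: B_def)
      ultimately show ?thesis by linarith
    qed
  qed
qed

text \<open>During the first \<open>q\<close> steps the rotation by \<open>\<alpha>\<close> stays within \<open>1 / q\<close> of the rotation by
  \<open>p / q\<close>, whose orbit is the grid of mesh \<open>1 / q\<close>. The midpoint of the interval is within
  \<open>1 / q\<close> of the grid, hence within \<open>2 / q\<close> of the orbit.\<close>

lemma rotation_orbit_meets_interval: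
  fixes p q :: int
  assumes "coprime p q" and q: "0 < q" and approx: "\<bar>of_int q * \<alpha> - of_int p\<bar> \<le> 1 / of_int q"
    and m: "4 / of_int q \<le> m"
  obtains j :: nat and k :: int
  where "int j < q" "a < real j * \<alpha> + of_int k" "real j * \<alpha> + of_int k < a + m"
proof -
  let ?q = "of_int q :: real"
  define i where "i = \<lfloor>(a + m / 2) * ?q\<rfloor>"
  obtain w u where wu: "w * p + u * q = 1"
    using bezout_int[of p q] \<open>coprime p q\<close> by auto
  \<comment> \<open>As \<^term>\<open>w\<close> inverts \<^term>\<open>p\<close> modulo \<^term>\<open>q\<close>, this is the
    orbit point whose rational model is the grid point just below the centre of the interval.\<close>
  define j where "j = nat ((w * i) mod q)"
  have j: "int j = (w * i) mod q" "int j < q" using q by (auto simp: j_def)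
  define k where "k = p * ((w * i) div q) + i * u"
  have wi: "w * i = q * ((w * i) div q) + int j" by (simp add: j(1))
  have "i = p * (w * i) + i * u * q"
    using arg_cong[OF wu, of "\<lambda>z. i * z"] by (simp add: algebra_simps)
  also have "\<dots> = p * int j + q * k"
    by (subst wi) (simp add: k_def algebra_simps)
  finally have k: "i = p * int j + q * k" .
  define y where "y = real j * \<alpha> + of_int k"
  have "y * ?q - of_int i = real j * (?q * \<alpha> - of_int p)"
  proof -
    have "of_int i = (of_int (p * int j + q * k) :: real)" by (simp only: flip: k)
    then show ?thesis by (simp add: y_def algebra_simps)
  qed
  then have "\<bar>y * ?q - of_int i\<bar> = real j * \<bar>?q * \<alpha> - of_int p\<bar>" by (simp add: abs_mult)
  also have "\<dots> \<le> real j * (1 / ?q)" by (intro mult_left_mono approx) simp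
  also have "\<dots> < 1" using j(2) q by (simp add: divide_less_eq)
  finally have "\<bar>y * ?q - of_int i\<bar> < 1" .
  moreover have "\<bar>of_int i - (a + m / 2) * ?q\<bar> < 1"
    unfolding i_def by linarith
  moreover have "4 \<le> m * ?q" using m q by (simp add: divide_le_eq)
  ultimately have "a * ?q < y * ?q" "y * ?q < (a + m) * ?q"
    by (auto simp: abs_less_iff algebra_simps)
  then have "a < y" "y < a + m" using q by auto
  then show ?thesis using that[of j k] j(2) by (simp add: y_def)
qed

text \<open>Dirichlet gives a denominator \<open>q \<le> Q\<close> with error below \<open>1 / Q\<close>, and the Diophantine
  condition forbids such a good approximation unless \<open>q\<close> is at least of order
  \<open>Q powr (1 / \<mu>)\<close>. With \<open>Q\<close> of order \<open>m powr (- \<mu>)\<close> this makes \<open>q \<ge> 4 / m\<close>, so that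
  the first \<open>q\<close> orbit points already meet the interval.\<close>

lemma diophantine_return_time:
  assumes irr: "\<alpha> \<notin> \<rat>" and dio: "diophantine_class \<alpha> \<nu>" and mu: "\<nu> < ereal \<mu>" "0 < \<mu>"
  obtains C where "C > 0"
    "\<And>a m. 0 < m \<Longrightarrow> m \<le> 1 \<Longrightarrow> \<exists>(j::nat) (k::int). real j + 1 \<le> C * m powr (- \<mu>) \<and>
        a < real j * \<alpha> + of_int k \<and> real j * \<alpha> + of_int k < a + m"
proof -
  obtain c where c: "c > 0"
    "\<And>q::nat. q > 0 \<Longrightarrow> c * real q powr (- \<mu>) \<le> dist_int (real q * \<alpha>)"
    using diophantine_class_lower_bound[OF irr dio mu(1)] by metis
  define C where "C = 4 powr \<mu> / c + 1"
  show ?thesis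
  proof
    show "C > 0" using c by (simp add: C_def add_pos_pos)
    fix a m :: real
    assume m: "0 < m" "m \<le> 1"
    \<comment> \<open>The least \<open>Q\<close> for which \<open>c Q\<close> reaches the power \<open>\<mu>\<close> of \<open>4 / m\<close>.\<close>
    define Q where "Q = nat \<lceil>(4 / m) powr \<mu> / c\<rceil>"
    have pos: "0 < (4 / m) powr \<mu> / c" using m c by simp
    then have Q: "0 < Q" "(4 / m) powr \<mu> / c \<le> real Q" "real Q \<le> (4 / m) powr \<mu> / c + 1"
      unfolding Q_def by linarith+
    obtain p q where pq: "coprime p q" "0 < q" "q \<le> int Q" "\<bar>of_int q * \<alpha> - of_int p\<bar> < 1 / real Q"
      using Dirichlet_approx_coprime[OF Q(1)] by metis
    define n where "n = nat q"
    have n: "q = int n" "n > 0" using pq(2) by (auto simp: n_def)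
    have "c * real n powr (- \<mu>) \<le> dist_int (real n * \<alpha>)" using c(2) n(2) .
    also have "\<dots> \<le> \<bar>of_int q * \<alpha> - of_int p\<bar>" using dist_int_le[of "real n * \<alpha>" p] n by simp
    also have "\<dots> < 1 / real Q" by (rule pq(4))
    finally have "c * real Q < real n powr \<mu>"
      using n(2) Q(1) by (simp add: powr_minus field_simps)
    moreover have "(4 / m) powr \<mu> \<le> c * real Q" using Q(2) c by (simp add: field_simps)
    ultimately have "(4 / m) powr \<mu> < real n powr \<mu>" by linarith
    then have "4 / m < real n"
      using powr_mono2[of \<mu> "real n" "4 / m"] mu m by (cases "4 / m < real n") auto
    then have "4 / of_int q \<le> m" using m n by (simp add: field_simps)
    moreover have "\<bar>of_int q * \<alpha> - of_int p\<bar> \<le> 1 / of_int q"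
    proof -
      have "1 / real Q \<le> 1 / of_int q" using pq by (intro divide_left_mono) auto
      then show ?thesis using pq(4) by linarith
    qed
    ultimately obtain j :: nat and k :: int where jk: "int j < q"
        "a < real j * \<alpha> + of_int k" "real j * \<alpha> + of_int k < a + m"
      using rotation_orbit_meets_interval[OF pq(1,2)] by metis
    have "real j + 1 \<le> real Q" using jk(1) pq(3) by linarith
    also have "\<dots> \<le> 4 powr \<mu> / c * m powr (- \<mu>) + 1"
      using Q(3) m by (simp add: powr_divide powr_minus_divide mult.commute)
    also have "\<dots> \<le> 4 powr \<mu> / c * m powr (- \<mu>) + m powr (- \<mu>)"
      using powr_mono2'[of "- \<mu>" m 1] m mu by simp
    also have "\<dots> = C * m powr (- \<mu>)" by (simp add: C_def algebra_simps)
    finally show "\<exists>(j::nat) (k::int). real j + 1 \<le> C * m powr (- \<mu>) \<and>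
        a < real j * \<alpha> + of_int k \<and> real j * \<alpha> + of_int k < a + m"
      using jk(2,3) by blast
  qed
qed

section \<open>Hoelder continuity of the semi-conjugacy\<close>

lemma circle_lift_add_of_int:
  assumes "circle_lift H h"
  shows "H (x + of_int k) = H x + of_int k"
proof -
  have step: "H (y + 1) = H y + 1" for y using assms by (auto simp: circle_lift_def)
  have nat: "H (y + real n) = H y + real n" for y and n :: nat
  proof (induction n)
    case (Suc n)
    then show ?case using step[of "y + real n"] by (simp add: algebra_simps)
  qed simp
  show ?thesis
  proof (cases "k \<ge> 0")
    case True
    then show ?thesis using nat[of x "nat k"] by simp
  next
    case False
    then show ?thesis using nat[of "x + of_int k" "nat (- k)"] by simp
  qed
qed

text \<open>On the arc the lift is continuous with values in a translate of the integers, hence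
  constant; the freedom in \<open>k\<close> selects the copy of the arc on which the constant is the
  prescribed representative \<open>z\<close>.\<close>

lemma circle_lift_constant_on_collapsed_arc:
  assumes lift: "circle_lift H h" and img: "\<And>t. t \<in> {a<..<b} \<Longrightarrow> h (circ t) = circ z"
    and ab: "a < b"
  obtains k :: int where "\<And>t. t \<in> {a + of_int k<..<b + of_int k} \<Longrightarrow> H t = z"
proof -
  have int: "H t - z \<in> \<int>" if "t \<in> {a<..<b}" for t
    using img[OF that] lift by (simp add: circle_lift_def circ_eq_iff)
  have "H constant_on {a<..<b}"
  proof (rule continuous_discrete_range_constant)
    show "continuous_on {a<..<b} H"
      using lift by (auto simp: circle_lift_def intro: continuous_on_subset)
    fix x assume x: "x \<in> {a<..<b}"
    have "1 \<le> norm (H y - H x)" if "y \<in> {a<..<b}" "H y \<noteq> H x" for y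
    proof -
      have "H y - H x \<in> \<int>" using Ints_diff[OF int[OF that(1)] int[OF x]] by simp
      then show ?thesis using Ints_nonzero_abs_ge1[of "H y - H x"] that(2) by simp
    qed
    then show "\<exists>e>0. \<forall>y. y \<in> {a<..<b} \<and> H y \<noteq> H x \<longrightarrow> e \<le> norm (H y - H x)"
      by (intro exI[of _ 1]) auto
  qed simp
  then obtain v where v: "\<And>t. t \<in> {a<..<b} \<Longrightarrow> H t = v" by (auto simp: constant_on_def)
  obtain k where k: "v - z = of_int k"
    using int[of "(a + b) / 2"] v[of "(a + b) / 2"] ab by (auto elim: Ints_cases)
  show ?thesis
  proof
    fix t assume "t \<in> {a + of_int (- k)<..<b + of_int (- k)}"
    then have "H (t + of_int k) = v" by (intro v) auto
    then show "H t = z" using k circle_lift_add_of_int[OF lift, of t k] by simp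
  qed
qed

lemma mono_collapsed_interval_length_le:
  fixes H :: "real \<Rightarrow> real"
  assumes "mono H" and const: "\<And>t. t \<in> {a<..<b} \<Longrightarrow> H t = z"
    and z: "H x < z" "z < H y" and xy: "x \<le> y"
  shows "b - a \<le> y - x"
proof (cases "a < b")
  case True
  have in_xy: "x < t \<and> t < y" if "t \<in> {a<..<b}" for t
    using const[OF that] z monoD[OF \<open>mono H\<close>, of t x] monoD[OF \<open>mono H\<close>, of y t] by force
  have "{a<..<b} \<subseteq> {x..y}" using in_xy by force
  then have "{a..b} \<subseteq> {x..y}"
    using True closure_minimal[of "{a<..<b}" "{x..y}"] by (simp add: closure_greaterThanLessThan)
  then show ?thesis using True by auto
qed (use xy in auto)

text \<open>The image of \<open>[x, y]\<close>, of length \<open>m\<close>, contains an early orbit point in its interior, so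
  \<open>[x, y]\<close> contains the interval collapsed to it. Reading the lower bound for the length \<open>l j\<close>
  backwards gives \<open>(y - x) powr (- s \<mu>) \<le> A (j + 1) \<le> A C m powr (- \<mu>)\<close>.\<close>

lemma holder_of_collapsed_intervals:
  fixes H :: "real \<Rightarrow> real"
  assumes mono: "mono H" and period: "\<And>x. H (x + 1) = H x + 1"
    and gap: "\<And>j (k::int). \<exists>e. \<forall>t\<in>{e<..<e + l j}. H t = real j * \<alpha> + of_int k"
    and l: "\<And>j. 0 < l j" "\<And>j. l j powr (- (s * \<mu>)) \<le> A * (real j + 1)"
    and return: "\<And>a m. 0 < m \<Longrightarrow> m \<le> 1 \<Longrightarrow>
      \<exists>(j::nat) (k::int). real j + 1 \<le> C * m powr (- \<mu>) \<and>
        a < real j * \<alpha> + of_int k \<and> real j * \<alpha> + of_int k < a + m"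
    and pos: "0 < s" "0 < \<mu>" "0 < A" "0 < C"
  shows "x \<le> y \<Longrightarrow> y \<le> x + 1 \<Longrightarrow> H y - H x \<le> (A * C) powr (1 / \<mu>) * (y - x) powr s"
proof -
  assume xy: "x \<le> y" "y \<le> x + 1"
  define m where "m = H y - H x"
  show ?thesis
  proof (cases "m > 0")
    case False
    then show ?thesis unfolding m_def
      using powr_ge_zero[of "A * C" "1 / \<mu>"] powr_ge_zero[of "y - x" s]
      by (smt (verit) mult_nonneg_nonneg)
  next
    case True
    have "m \<le> 1" using monoD[OF mono xy(2)] period[of x] by (simp add: m_def)
    from return[OF True this, of "H x"] obtain j :: nat and k :: int where jk: "real j + 1 \<le> C * m powr (- \<mu>)"
      "H x < real j * \<alpha> + of_int k" "real j * \<alpha> + of_int k < H x + m" by blast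
    from gap[of j k] obtain e where e: "\<And>t. t \<in> {e<..<e + l j} \<Longrightarrow> H t = real j * \<alpha> + of_int k"
      by blast
    have "l j \<le> y - x"
      using mono_collapsed_interval_length_le[of H e "e + l j", OF mono e jk(2) _ xy(1)] jk(3)
      by (simp add: m_def)
    moreover have "0 < y - x" using calculation l(1)[of j] by linarith
    ultimately have "(y - x) powr (- (s * \<mu>)) \<le> l j powr (- (s * \<mu>))"
      using l(1)[of j] pos by (intro powr_mono2') auto
    also have "\<dots> \<le> A * (real j + 1)" by (rule l(2))
    also have "\<dots> \<le> A * (C * m powr (- \<mu>))" using jk(1) pos by simp
    finally have "m powr \<mu> \<le> A * C * (y - x) powr (s * \<mu>)"
      using True \<open>0 < y - x\<close> by (simp add: powr_minus field_simps)
    then have "(m powr \<mu>) powr (1 / \<mu>) \<le> (A * C * (y - x) powr (s * \<mu>)) powr (1 / \<mu>)"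
      using pos by (intro powr_mono2) auto
    then show ?thesis
      using True pos \<open>0 < y - x\<close> by (simp add: powr_powr powr_mult m_def)
  qed
qed

section \<open>Mass distribution on the circle\<close>

lemma ex_circ: "\<exists>x. p = circ x"
  by transfer (metis diff_self Ints_0)

text \<open>The distance on the circle is the distance of \<open>y - x\<close> to some integer \<open>i\<close>. Since both this
  distance and \<open>\<bar>y - x\<bar>\<close> are at most 1, only five values of \<open>i\<close> are possible.\<close>

lemma circle_set_in_short_interval:
  assumes U: "bounded U" "diameter U \<le> 1" and x: "0 \<le> x" "x \<le> 1" "circ x \<in> U"
    and y: "0 \<le> y" "y \<le> 1" "circ y \<in> U"
  shows "\<exists>i\<in>{-2..2::int}. y - of_int i \<in> {x - diameter U..x + diameter U}"
proof -
  have "dist_int (y - x) \<le> diameter U"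
    using diameter_bounded_bound[OF U(1) y(3) x(3)] by (simp add: dist_circ)
  then have "\<bar>y - x - of_int (round (y - x))\<bar> \<le> diameter U" by (simp add: dist_int_def)
  moreover have "round (y - x) \<in> {-2..2}"
    using calculation U x y by (auto simp: abs_le_iff)
  ultimately show ?thesis by (intro bexI[of _ "round (y - x)"]) (auto simp: abs_le_iff)
qed

text \<open>One period of values of \<open>H\<close> has length 1. Apart from a countable set it consists of values at points
  over \<open>Y\<close>, and each member of the cover accounts for at most five integer translates of
  a single interval of values, all of the same length.\<close>

lemma mass_le_sum_of_increments:
  fixes H :: "real \<Rightarrow> real" and Y :: "circle set" and U :: "nat \<Rightarrow> circle set"
  assumes lift: "circle_lift H h" and mono: "mono H"
    and count: "countable (H ` {t. circ t \<notin> Y})"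
    and U: "\<And>k. bounded (U k)" "\<And>k. diameter (U k) \<le> 1" "Y \<subseteq> (\<Union>k. U k)"
    and z: "\<And>k. U k \<noteq> {} \<Longrightarrow> 0 \<le> z k \<and> z k \<le> 1 \<and> circ (z k) \<in> U k"
  shows "1 \<le> 5 * (\<Sum>k. if U k = {} then 0
      else ennreal (H (z k + diameter (U k)) - H (z k - diameter (U k))))"
proof -
  let ?d = "\<lambda>k. diameter (U k)"
  define I where "I k i = (if U k = {} then {} else {H (z k - ?d k) + of_int i..H (z k + ?d k) + of_int i})"
    for k and i :: int
  define N where "N = H ` {t. circ t \<notin> Y}"
  have N: "N \<in> null_sets lborel" using count by (auto simp: N_def intro: countable_imp_null_set_lborel)
  have I [simp]: "I k i \<in> sets borel" for k i by (simp add: I_def)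
  have UI: "(\<Union>i\<in>{-2..2}. I k i) \<in> sets borel" for k by (intro sets.finite_UN) auto
  then have UUI: "(\<Union>k. \<Union>i\<in>{-2..2}. I k i) \<in> sets borel" by (intro sets.countable_UN) auto
  have cont: "continuous_on UNIV H" and "H (0 + 1) = H 0 + 1"
    using lift unfolding circle_lift_def by blast+
  have cover: "{H 0..H 0 + 1} \<subseteq> N \<union> (\<Union>k. \<Union>i\<in>{-2..2}. I k i)"
  proof
    fix v assume "v \<in> {H 0..H 0 + 1}"
    then obtain t where t: "0 \<le> t" "t \<le> 1" "H t = v"
      using IVT'[of H 0 v 1] continuous_on_subset[OF cont, of "{0..1}"] \<open>H (0 + 1) = H 0 + 1\<close> by auto
    show "v \<in> N \<union> (\<Union>k. \<Union>i\<in>{-2..2}. I k i)"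
    proof (cases "circ t \<in> Y")
      case False
      then show ?thesis using t by (auto simp: N_def)
    next
      case True
      then obtain k where k: "circ t \<in> U k" using U(3) by auto
      then have ne: "U k \<noteq> {}" by auto
      obtain i :: int where i: "i \<in> {-2..2}" "t - of_int i \<in> {z k - ?d k..z k + ?d k}"
        using circle_set_in_short_interval[OF U(1,2), of "z k" k t] z[OF ne] t k by auto
      have "H (t - of_int i) = v - of_int i"
        using circle_lift_add_of_int[OF lift, of t "- i"] t(3) by simp
      then have "v \<in> I k i"
        using i(2) ne monoD[OF mono, of "z k - ?d k" "t - of_int i"]
          monoD[OF mono, of "t - of_int i" "z k + ?d k"] by (auto simp: I_def)
      then show ?thesis using i(1) by auto
    qed
  qed
  have meas: "emeasure lborel (I k i) = (if U k = {} then 0 else ennreal (H (z k + ?d k) - H (z k - ?d k)))"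
    for k i
    using monoD[OF mono, of "z k - ?d k" "z k + ?d k"] diameter_ge_0[OF U(1)]
    by (auto simp: I_def)
  have "1 = emeasure lborel {H 0..H 0 + 1}" by simp
  also have "\<dots> \<le> emeasure lborel (N \<union> (\<Union>k. \<Union>i\<in>{-2..2}. I k i))"
    using cover null_setsD2[OF N] UUI by (intro emeasure_mono sets.Un) auto
  also have "\<dots> = emeasure lborel (\<Union>k. \<Union>i\<in>{-2..2}. I k i)"
    using N UUI by (subst Un_commute, intro emeasure_Un_null_set) auto
  also have "\<dots> \<le> (\<Sum>k. emeasure lborel (\<Union>i\<in>{-2..2}. I k i))"
    using UI by (intro emeasure_subadditive_countably) auto
  also have "\<dots> \<le> (\<Sum>k. \<Sum>i\<in>{-2..2::int}. emeasure lborel (I k i))"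
    by (intro suminf_le emeasure_subadditive_finite) auto
  also have "\<dots> = (\<Sum>k. 5 * (if U k = {} then 0 else ennreal (H (z k + ?d k) - H (z k - ?d k))))"
    unfolding meas by simp
  finally show ?thesis by simp
qed

text \<open>The mass distribution principle. The Hoelder condition turns the total increment of \<open>H\<close> over a
  cover into a positive lower bound for its \<open>s\<close>-sum; diameters below 1 make the \<open>\<beta>\<close>-sum at least as large for
  every \<open>\<beta> < s\<close>, including \<open>\<beta> = 0\<close>.\<close>

lemma hausdorff_dim_ge_of_holder_lift:
  fixes H :: "real \<Rightarrow> real" and Y :: "circle set"
  assumes lift: "circle_lift H h" and mono: "mono H"
    and count: "countable (H ` {t. circ t \<notin> Y})"
    and holder: "\<And>x y. x \<le> y \<Longrightarrow> y \<le> x + 1 \<Longrightarrow> H y - H x \<le> C * (y - x) powr s"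
    and s: "0 < s" and C: "0 < C"
  shows "ereal s \<le> hausdorff_dim Y"
  unfolding hausdorff_dim_def
proof (rule Inf_greatest, clarify)
  fix \<beta> :: real assume \<beta>: "0 \<le> \<beta>" and null: "hausdorff_measure \<beta> Y = 0"
  show "ereal s \<le> ereal \<beta>"
  proof (rule ccontr)
    assume "\<not> ereal s \<le> ereal \<beta>"
    then have "\<beta> < s" by simp
    \<comment> \<open>A set of diameter \<open>d\<close> is only known to lie in an interval of length \<open>2 d\<close>, whence the factor
      \<open>2 powr s\<close> here and the bound \<open>1 / 2\<close> on the diameters below.\<close>
    define K where "K = C * 2 powr s"
    have K: "K > 0" using C by (simp add: K_def)
    have sum: "1 \<le> ennreal (5 * K) * (\<Sum>k. diam_pow \<beta> (U k))"
      if U: "\<And>k. bounded (U k)" "\<And>k. diameter (U k) < 1 / 2" "Y \<subseteq> (\<Union>k. U k)"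
      for U :: "nat \<Rightarrow> circle set"
    proof -
      have "\<exists>x. U k \<noteq> {} \<longrightarrow> 0 \<le> x \<and> x \<le> 1 \<and> circ x \<in> U k" for k
      proof (cases "U k = {}")
        case False
        then obtain p where "p \<in> U k" by auto
        moreover obtain x where "p = circ x" using ex_circ by blast
        moreover have "circ x = circ (frac x)" by (simp add: circ_eq_iff frac_def)
        ultimately show ?thesis
          using frac_ge_0[of x] frac_lt_1[of x] by (intro exI[of _ "frac x"]) auto
      qed auto
      then obtain z where z: "\<And>k. U k \<noteq> {} \<Longrightarrow> 0 \<le> z k \<and> z k \<le> 1 \<and> circ (z k) \<in> U k"
        by metis
      have mass: "(if U k = {} then 0
          else ennreal (H (z k + diameter (U k)) - H (z k - diameter (U k)))) \<le> ennreal K * diam_pow \<beta> (U k)" for k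
      proof (cases "U k = {}")
        case False
        let ?d = "diameter (U k)"
        have d: "0 \<le> ?d" "?d < 1 / 2" using U diameter_ge_0 by auto
        have "H (z k + ?d) - H (z k - ?d) \<le> C * (z k + ?d - (z k - ?d)) powr s"
          by (rule holder) (use d in auto)
        also have "\<dots> = K * ?d powr s" using d by (simp add: K_def powr_mult)
        finally have "ennreal (H (z k + ?d) - H (z k - ?d)) \<le> ennreal K * ennreal (?d powr s)"
          using K by (simp add: ennreal_leI flip: ennreal_mult)
        also have "ennreal (?d powr s) \<le> diam_pow \<beta> (U k)"
        proof (cases "\<beta> = 0")
          case True
          have "?d powr s \<le> 1" using d s powr_le1[of s ?d] by simp
          then show ?thesis using True False by (simp add: diam_pow_def)
        next
          case \<beta>0: False
          have "?d powr s \<le> ?d powr \<beta>" using d \<open>\<beta> < s\<close> by (intro powr_mono') auto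
          then show ?thesis using \<beta>0 False by (simp add: diam_pow_def ennreal_leI)
        qed
        finally show ?thesis using False by (simp add: mult_left_mono)
      qed simp
      have "1 \<le> 5 * (\<Sum>k. if U k = {} then 0
          else ennreal (H (z k + diameter (U k)) - H (z k - diameter (U k))))"
      proof (rule mass_le_sum_of_increments[OF lift mono count U(1) _ U(3) z])
        show "diameter (U k) \<le> 1" for k using U(2)[of k] by simp
      qed
      also have "\<dots> \<le> 5 * (\<Sum>k. ennreal K * diam_pow \<beta> (U k))"
        by (intro mult_left_mono suminf_le mass) auto
      also have "\<dots> = ennreal (5 * K) * (\<Sum>k. diam_pow \<beta> (U k))"
        using K by (simp add: ennreal_mult mult.assoc)
      finally show ?thesis .
    qed
    have "ennreal (1 / (5 * K)) \<le> hausdorff_premeasure \<beta> (1 / 2) Y"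
      unfolding hausdorff_premeasure_def
    proof (rule INF_greatest, clarify)
      fix U :: "nat \<Rightarrow> circle set"
      assume "\<forall>k. bounded (U k) \<and> diameter (U k) < 1 / 2" "Y \<subseteq> (\<Union>k. U k)"
      then have "1 \<le> ennreal (5 * K) * (\<Sum>k. diam_pow \<beta> (U k))" by (intro sum) auto
      then have "ennreal (1 / (5 * K)) * 1 \<le> ennreal (1 / (5 * K)) * (ennreal (5 * K) * (\<Sum>k. diam_pow \<beta> (U k)))"
        by (rule mult_left_mono) simp
      also have "\<dots> = (\<Sum>k. diam_pow \<beta> (U k))"
        using K by (simp flip: mult.assoc ennreal_mult)
      finally show "ennreal (1 / (5 * K)) \<le> (\<Sum>k. diam_pow \<beta> (U k))" by simp
    qed
    also have "\<dots> \<le> hausdorff_measure \<beta> Y"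
      unfolding hausdorff_measure_eq_SUP by (rule SUP_upper) simp
    finally show False using null K by simp
  qed
qed

section \<open>The dimension of the minimal set\<close>

text \<open>The exponent \<open>\<sigma> = s \<mu>\<close> governs the lengths and \<open>\<mu>\<close> the return times, so the lift is Hoelder
  continuous with exponent \<open>\<sigma> / \<mu> = s\<close>.\<close>

lemma denjoy_dim_ge:
  assumes \<delta>: "\<delta> < 1" and irr: "\<alpha> \<notin> \<rat>" and dio: "diophantine_class \<alpha> \<nu>"
    and denjoy: "denjoy_map \<delta> \<alpha> \<l> J f"
    and s: "0 < s" "s * \<mu> < \<delta>" and mu: "0 < \<mu>" "\<nu> < ereal \<mu>"
  shows "ereal s \<le> hausdorff_dim (UNIV - (\<Union>n. J n))"
proof -
  have seq: "denjoy_sequence \<delta> \<l>" and arc: "\<And>n. \<exists>a. J n = open_arc a (\<l> n)"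
    using denjoy unfolding denjoy_map_def by blast+
  have pos: "\<And>n. \<l> n > 0" using seq by (auto simp: denjoy_sequence_def)
  obtain h where "denjoy_semiconjugacy \<alpha> J f h"
    using denjoy by (auto simp only: denjoy_map_def)
  then have "circle_monotone h" and collapse: "\<And>n. h ` closure (J n) = {circ (of_int n * \<alpha>)}"
    by (auto simp only: denjoy_semiconjugacy_def)
  then obtain H where lift: "circle_lift H h" and mono: "mono H"
    by (auto simp only: circle_monotone_def)
  have hJ: "h p = circ (of_int n * \<alpha>)" if "p \<in> J n" for n p
    using collapse[of n] closure_subset[of "J n"] that by auto
  have gap: "\<exists>e. \<forall>t\<in>{e<..<e + \<l> (int j)}. H t = real j * \<alpha> + of_int k" for j :: nat and k :: int
  proof -
    obtain a where a: "J (int j) = open_arc a (\<l> (int j))" using arc by blast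
    have "h (circ t) = circ (real j * \<alpha> + of_int k)" if "t \<in> {a<..<a + \<l> (int j)}" for t
    proof -
      have "h (circ t) = circ (of_int (int j) * \<alpha>)"
        using that by (intro hJ) (simp add: a open_arc_def)
      also have "\<dots> = circ (real j * \<alpha> + of_int k)" by (simp add: circ_eq_iff)
      finally show ?thesis .
    qed
    then obtain i :: int where
      "\<And>t. t \<in> {a + of_int i<..<a + \<l> (int j) + of_int i} \<Longrightarrow> H t = real j * \<alpha> + of_int k"
      using circle_lift_constant_on_collapsed_arc[OF lift] pos[of "int j"] by (metis less_add_same_cancel1)
    then show ?thesis by (intro exI[of _ "a + of_int i"]) (simp add: algebra_simps)
  qed
  obtain A where A: "A > 0" "\<And>n::nat. \<l> (int n) powr (- (s * \<mu>)) \<le> A * (real n + 1)"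
    using denjoy_sequence_forward_lower_bound[OF seq _ s(2) \<delta>] s(1) mu(1) by (metis mult_pos_pos)
  obtain C where C: "C > 0" "\<And>a m. 0 < m \<Longrightarrow> m \<le> 1 \<Longrightarrow>
      \<exists>(j::nat) (k::int). real j + 1 \<le> C * m powr (- \<mu>) \<and>
        a < real j * \<alpha> + of_int k \<and> real j * \<alpha> + of_int k < a + m"
    using diophantine_return_time[OF irr dio mu(2,1)] by metis
  have holder: "H y - H x \<le> (A * C) powr (1 / \<mu>) * (y - x) powr s" if "x \<le> y" "y \<le> x + 1" for x y
    by (rule holder_of_collapsed_intervals[OF mono _ gap pos A(2) C(2) s(1) mu(1) A(1) C(1) that])
       (use lift in \<open>auto simp: circle_lift_def\<close>)
  have "H ` {t. circ t \<notin> UNIV - (\<Union>n. J n)} \<subseteq> range (\<lambda>(n::int, k::int). of_int n * \<alpha> + of_int k)"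
  proof (rule image_subsetI)
    fix t assume "t \<in> {t. circ t \<notin> UNIV - (\<Union>n. J n)}"
    then obtain n where "circ t \<in> J n" by auto
    then have "circ (H t) = circ (of_int n * \<alpha>)" using hJ[of "circ t" n] lift by (simp add: circle_lift_def)
    then obtain k where "H t - of_int n * \<alpha> = of_int k" by (auto simp: circ_eq_iff elim: Ints_cases)
    then show "H t \<in> range (\<lambda>(n::int, k::int). of_int n * \<alpha> + of_int k)"
      by (intro image_eqI[of _ _ "(n, k)"]) auto
  qed
  then have "countable (H ` {t. circ t \<notin> UNIV - (\<Union>n. J n)})"
    by (rule countable_subset) (intro countable_image, simp)
  from hausdorff_dim_ge_of_holder_lift[OF lift mono this holder s(1)] A(1) C(1)
  show ?thesis by simp
qed

theorem proposition12:
  fixes \<delta> \<alpha> :: real and \<nu> :: ereal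
    and \<l> :: "int \<Rightarrow> real" and J :: "int \<Rightarrow> circle set" and f :: "circle \<Rightarrow> circle"
  assumes "0 < \<delta>" and "\<delta> < 1"
    and "0 < \<alpha>" and "\<alpha> < 1" and "\<alpha> \<notin> \<rat>"
    and "1 \<le> \<nu>" and "diophantine_class \<alpha> \<nu>"
    and "denjoy_map \<delta> \<alpha> \<l> J f"
  shows "hausdorff_dim (UNIV - (\<Union>n. J n)) \<ge> ereal \<delta> / \<nu>"
proof (cases \<nu>)
  case PInf
  have "0 \<le> hausdorff_dim (UNIV - (\<Union>n. J n))"
    unfolding hausdorff_dim_def by (rule Inf_greatest) auto
  then show ?thesis using PInf by simp
next
  case MInf
  then show ?thesis using \<open>1 \<le> \<nu>\<close> by simp
next
  case (real v)
  have v: "1 \<le> v" using \<open>1 \<le> \<nu>\<close> real by simp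
  have "ereal (\<delta> / v) \<le> hausdorff_dim (UNIV - (\<Union>n. J n))"
  proof (rule dense_le)
    fix e assume "e < ereal (\<delta> / v)"
    moreover have "0 < ereal (\<delta> / v)" using v \<open>0 < \<delta>\<close> by simp
    ultimately have "max 0 e < ereal (\<delta> / v)" by simp
    then obtain s where s: "max 0 e < ereal s" "ereal s < ereal (\<delta> / v)"
      using ereal_dense2 by blast
    then have s0: "0 < s" and "e \<le> ereal s" and "v < \<delta> / s"
      using v by (auto simp: field_simps)
    then obtain \<mu> where \<mu>: "v < \<mu>" "\<mu> < \<delta> / s" using dense by blast
    have "ereal s \<le> hausdorff_dim (UNIV - (\<Union>n. J n))"
      by (rule denjoy_dim_ge[OF \<open>\<delta> < 1\<close> \<open>\<alpha> \<notin> \<rat>\<close> \<open>diophantine_class \<alpha> \<nu>\<close> \<open>denjoy_map \<delta> \<alpha> \<l> J f\<close> s0])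
        (use \<mu> v s0 real in \<open>auto simp: field_simps\<close>)
    with \<open>e \<le> ereal s\<close> show "e \<le> hausdorff_dim (UNIV - (\<Union>n. J n))" by (rule order_trans)
  qed
  then show ?thesis using real v by simp
qed

end
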